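(* Let $G$ be a Type 1 NG-graph, let $a=|A_G|$, and let $\ell$ be the number of vertices in $C_G$ that are adjacent to every vertex in $B_G$. Then $G$ is an NGD-graph if and only if $D(G)=\max\{a,\ell\}$.
   Context: Graphs are finite and simple. $\overline{G}$ is the complement of $G$, $\chi$ the chromatic number, and $G[S]$ the subgraph induced by $S$. A coloring of $V(G)$ is distinguishing if the only automorphism of $G$ preserving all vertex colors is the identity; $D(G)$ is the minimum number of colors in a distinguishing coloring of $G$, and $\chi_D(G)$ is the minimum number of colors in a coloring of $G$ that is both proper and distinguishing. With $n=|V(G)|$, $G$ is an NG-graph if $\chi(G)+\chi(\overline{G})=n+1$, and an NGD-graph if $\chi_D(G)+\chi_D(\overline{G})=n+D(G)$. For an NG-graph $G$, $A_G=\{v:\deg(v)=\chi(G)-1\}$, $B_G=\{v:\deg(v)>\chi(G)-1\}$, $C_G=\{v:\deg(v)<\chi(G)-1\}$; $G$ is of Type 1 if $G[A_G]$ is a clique. *)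

theory Defs
  imports Main
begin

record 'a ugraph =
  verts :: "'a set"
  edges :: "'a set set"

definition simple_graph :: "'a ugraph \<Rightarrow> bool" where
  "simple_graph G \<longleftrightarrow>
     finite (verts G) \<and> (\<forall>e \<in> edges G. e \<subseteq> verts G \<and> card e = 2)"

definition adjacent :: "'a ugraph \<Rightarrow> 'a \<Rightarrow> 'a \<Rightarrow> bool" where
  "adjacent G u v \<longleftrightarrow> {u, v} \<in> edges G"

definition degree :: "'a ugraph \<Rightarrow> 'a \<Rightarrow> nat" where
  "degree G v = card {u \<in> verts G. adjacent G v u}"

definition graph_complement :: "'a ugraph \<Rightarrow> 'a ugraph" where
  "graph_complement G =
     \<lparr>verts = verts G,
      edges = {{u, v} | u v. u \<in> verts G \<and> v \<in> verts G \<and> u \<noteq> v \<and> \<not> adjacent G u v}\<rparr>"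

definition induced_subgraph :: "'a ugraph \<Rightarrow> 'a set \<Rightarrow> 'a ugraph" where
  "induced_subgraph G S = \<lparr>verts = verts G \<inter> S, edges = {e \<in> edges G. e \<subseteq> S}\<rparr>"

definition is_clique :: "'a ugraph \<Rightarrow> bool" where
  "is_clique G \<longleftrightarrow> (\<forall>u \<in> verts G. \<forall>v \<in> verts G. u \<noteq> v \<longrightarrow> adjacent G u v)"

text \<open>Automorphisms are functions on the whole type, of which only the values on the
  vertex set matter; hence being the identity is also required on the vertex set only.\<close>

definition automorphism :: "'a ugraph \<Rightarrow> ('a \<Rightarrow> 'a) \<Rightarrow> bool" where
  "automorphism G f \<longleftrightarrow>
     bij_betw f (verts G) (verts G) \<and>
     (\<forall>u \<in> verts G. \<forall>v \<in> verts G. adjacent G (f u) (f v) \<longleftrightarrow> adjacent G u v)"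

definition proper_coloring :: "'a ugraph \<Rightarrow> ('a \<Rightarrow> nat) \<Rightarrow> bool" where
  "proper_coloring G c \<longleftrightarrow>
     (\<forall>u \<in> verts G. \<forall>v \<in> verts G. adjacent G u v \<longrightarrow> c u \<noteq> c v)"

definition distinguishing :: "'a ugraph \<Rightarrow> ('a \<Rightarrow> nat) \<Rightarrow> bool" where
  "distinguishing G c \<longleftrightarrow>
     (\<forall>f. automorphism G f \<and> (\<forall>v \<in> verts G. c (f v) = c v) \<longrightarrow> (\<forall>v \<in> verts G. f v = v))"

definition chromatic_number :: "'a ugraph \<Rightarrow> nat" where
  "chromatic_number G = (LEAST k. \<exists>c. c ` verts G \<subseteq> {..<k} \<and> proper_coloring G c)"

definition distinguishing_number :: "'a ugraph \<Rightarrow> nat" where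
  "distinguishing_number G = (LEAST k. \<exists>c. c ` verts G \<subseteq> {..<k} \<and> distinguishing G c)"

definition distinguishing_chromatic_number :: "'a ugraph \<Rightarrow> nat" where
  "distinguishing_chromatic_number G =
     (LEAST k. \<exists>c. c ` verts G \<subseteq> {..<k} \<and> proper_coloring G c \<and> distinguishing G c)"

definition NG_graph :: "'a ugraph \<Rightarrow> bool" where
  "NG_graph G \<longleftrightarrow>
     chromatic_number G + chromatic_number (graph_complement G) = card (verts G) + 1"

definition NGD_graph :: "'a ugraph \<Rightarrow> bool" where
  "NGD_graph G \<longleftrightarrow>
     distinguishing_chromatic_number G + distinguishing_chromatic_number (graph_complement G)
       = card (verts G) + distinguishing_number G"

text \<open>The comparisons of \<open>deg v\<close> with \<open>\<chi>(G) - 1\<close> are written with \<open>deg v + 1\<close> and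
  \<open>\<chi>(G)\<close> to avoid truncated subtraction on the natural numbers.\<close>

definition A_set :: "'a ugraph \<Rightarrow> 'a set" where
  "A_set G = {v \<in> verts G. degree G v + 1 = chromatic_number G}"

definition B_set :: "'a ugraph \<Rightarrow> 'a set" where
  "B_set G = {v \<in> verts G. degree G v + 1 > chromatic_number G}"

definition C_set :: "'a ugraph \<Rightarrow> 'a set" where
  "C_set G = {v \<in> verts G. degree G v + 1 < chromatic_number G}"

definition type1 :: "'a ugraph \<Rightarrow> bool" where
  "type1 G \<longleftrightarrow> is_clique (induced_subgraph G (A_set G))"

end

theory Submission
  imports Defs
begin

text \<open>
  Write \<open>a, b, c\<close> for the sizes of \<open>A, B, C\<close> (the sets \<open>A_set G\<close>, \<open>B_set G\<close>, \<open>C_set G\<close>).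

  Structure. For every graph of order \<open>n\<close> the chromatic numbers of the graph and of its complement
  add up to at most \<open>n + 1\<close>, so deleting a vertex of an NG-graph lowers one of them.
  If \<open>v \<in> B\<close>, then the degree of \<open>v\<close> in the complement is too small for \<open>\<chi>\<close> of the complement to drop, so \<open>\<chi>(G)\<close> drops
  (\<open>NG_delete_high_degree\<close>). Hence a vertex \<open>u\<close> of \<open>A \<union> B\<close> that is not adjacent to \<open>v \<in> B\<close> is
  impossible: the two deletions together would lower \<open>\<chi>\<close> by two, while one new colour suffices
  for both vertices. So \<open>B\<close> is a clique joined completely to \<open>A\<close>; dually \<open>C\<close> is stable with no
  edges to \<open>A\<close>; and a colour count shows that \<open>A\<close> is nonempty. In Type 1, moreover, \<open>A\<close> is a
  clique, so its vertices are pairwise twins.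

  Colour counts. Call vertices of \<open>C\<close> with the same neighbourhood a twin class. A proper
  distinguishing colouring must separate \<open>A \<union> B\<close> and every twin class \<open>T\<close>, and must keep the colours
  of \<open>T\<close> away from those of its neighbourhood \<open>N(T) \<subseteq> B\<close>; these conditions also suffice. So
  \<open>\<chi>\<^sub>D(G)\<close> is the maximum of \<open>a + b\<close> and all \<open>|T| + |N(T)|\<close>. In the complement \<open>B\<close> and \<open>C\<close>
  exchange their roles, which gives the maximum of \<open>a + c\<close> and all \<open>|S| + |N'(S)|\<close>, where \<open>S\<close>
  ranges over the twin classes in \<open>B\<close> and \<open>N'(S) \<subseteq> C\<close> is the set of non-neighbours in \<open>C\<close>. The
  locale \<open>split_like_graph\<close> covers both cases.

  Arithmetic. \<open>D(G)\<close> is at least the size of every set of pairwise twins, in particular at least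
  \<open>a\<close>, \<open>l\<close>, \<open>|T|\<close> and \<open>|S|\<close>; the number \<open>l\<close> is the size of the class with \<open>N(T) = B\<close>, or \<open>0\<close> if
  there is none. If the two maxima add up to \<open>a + b + c + D(G)\<close>, then a case distinction on where they are attained leaves only
  \<open>D(G) = a\<close> and \<open>D(G) = l\<close>. Conversely, if \<open>D(G) = max a l\<close>, then the maxima are
  \<open>b + max a l\<close> and \<open>a + c\<close>.
\<close>

section \<open>Basic facts on graphs, colourings and vertex deletion\<close>

definition nbhd :: "'a ugraph \<Rightarrow> 'a \<Rightarrow> 'a set" where
  "nbhd G v = {u \<in> verts G. adjacent G v u}"

abbreviation delete_verts :: "'a ugraph \<Rightarrow> 'a set \<Rightarrow> 'a ugraph" where
  "delete_verts G S \<equiv> induced_subgraph G (verts G - S)"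

lemma degree_nbhd: "degree G v = card (nbhd G v)"
  by (simp add: degree_def nbhd_def)

lemma adjacent_sym: "adjacent G u v \<longleftrightarrow> adjacent G v u"
  by (simp add: adjacent_def insert_commute)

lemma finite_verts: "simple_graph G \<Longrightarrow> finite (verts G)"
  by (simp add: simple_graph_def)

lemma finite_nbhd: "simple_graph G \<Longrightarrow> finite (nbhd G v)"
  by (simp add: simple_graph_def nbhd_def)

lemma not_adjacent_self: "simple_graph G \<Longrightarrow> \<not> adjacent G v v"
  by (auto simp: simple_graph_def adjacent_def)

lemma adjacent_in_verts: "simple_graph G \<Longrightarrow> adjacent G u v \<Longrightarrow> u \<in> verts G \<and> v \<in> verts G"
  by (auto simp: simple_graph_def adjacent_def)

lemma verts_complement [simp]: "verts (graph_complement G) = verts G"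
  by (simp add: graph_complement_def)

lemma adjacent_complement:
  "adjacent (graph_complement G) u v \<longleftrightarrow>
     u \<in> verts G \<and> v \<in> verts G \<and> u \<noteq> v \<and> \<not> adjacent G u v"
  by (auto simp: graph_complement_def adjacent_def doubleton_eq_iff insert_commute)

lemma simple_complement: "simple_graph G \<Longrightarrow> simple_graph (graph_complement G)"
  by (auto simp: simple_graph_def graph_complement_def)

lemma simple_graph_eqI:
  assumes "simple_graph G" "simple_graph H" "verts G = verts H"
    and "\<And>u v. adjacent G u v \<longleftrightarrow> adjacent H u v"
  shows "G = (H :: 'a ugraph)"
proof -
  have "e \<in> edges G \<longleftrightarrow> e \<in> edges H" for e
  proof (cases "card e = 2")
    case True
    then obtain u v where "e = {u, v}" by (auto simp: card_2_iff)
    then show ?thesis using assms(4)[of u v] by (simp add: adjacent_def)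
  next
    case False
    then show ?thesis using assms(1,2) by (auto simp: simple_graph_def)
  qed
  then have "edges G = edges H" by blast
  then show ?thesis using assms(3) by simp
qed

lemma complement_complement:
  assumes "simple_graph G" shows "graph_complement (graph_complement G) = G"
  using assms adjacent_in_verts[OF assms] not_adjacent_self[OF assms]
  by (intro simple_graph_eqI simple_complement) (auto simp: adjacent_complement)

lemma verts_induced [simp]: "verts (induced_subgraph G S) = verts G \<inter> S"
  by (simp add: induced_subgraph_def)

lemma adjacent_induced [simp]:
  "adjacent (induced_subgraph G S) u v \<longleftrightarrow> adjacent G u v \<and> u \<in> S \<and> v \<in> S"
  by (auto simp: induced_subgraph_def adjacent_def)

lemma simple_induced: "simple_graph G \<Longrightarrow> simple_graph (induced_subgraph G S)"
  by (auto simp: simple_graph_def induced_subgraph_def)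

lemma induced_induced:
  "induced_subgraph (induced_subgraph G S) T = induced_subgraph G (S \<inter> T)"
  by (auto simp: induced_subgraph_def)

lemma complement_induced:
  "simple_graph G \<Longrightarrow>
     graph_complement (induced_subgraph G S) = induced_subgraph (graph_complement G) S"
  by (intro simple_graph_eqI simple_complement simple_induced)
     (auto simp: adjacent_complement)

lemma card_delete_vertex:
  "simple_graph G \<Longrightarrow> v \<in> verts G \<Longrightarrow> Suc (card (verts (delete_verts G {v}))) = card (verts G)"
  using card_Suc_Diff1[OF finite_verts] by (simp add: Int_absorb1 del: card_Diff_insert)

lemma degree_complement:
  assumes "simple_graph G" "v \<in> verts G"
  shows "degree G v + degree (graph_complement G) v + 1 = card (verts G)"
proof -
  have "verts G = insert v (nbhd G v \<union> nbhd (graph_complement G) v)"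
    using assms adjacent_in_verts[OF assms(1)]
    by (auto simp: nbhd_def adjacent_complement)
  moreover have "v \<notin> nbhd G v \<union> nbhd (graph_complement G) v"
    using not_adjacent_self[OF assms(1)] by (auto simp: nbhd_def adjacent_complement)
  moreover have "card (nbhd G v \<union> nbhd (graph_complement G) v)
      = card (nbhd G v) + card (nbhd (graph_complement G) v)"
    using assms by (intro card_Un_disjoint finite_nbhd simple_complement)
      (auto simp: nbhd_def adjacent_complement)
  ultimately show ?thesis
    using assms by (simp add: degree_nbhd finite_nbhd simple_complement)
qed

text \<open>
  The three colouring parameters are all of this form. An injective colouring shows that the set
  of admissible \<open>k\<close> is nonempty; admissibility is upward closed, so comparing the minimum with
  \<open>k\<close> amounts to asking for a colouring with \<open>k\<close> colours.
\<close>

lemma least_colours_le_iff: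
  fixes Q :: "('a \<Rightarrow> nat) \<Rightarrow> bool"
  assumes "c0 ` V \<subseteq> {..<m}" "Q c0"
  shows "(LEAST k. \<exists>c. c ` V \<subseteq> {..<k} \<and> Q c) \<le> k \<longleftrightarrow> (\<exists>c. c ` V \<subseteq> {..<k} \<and> Q c)"
    (is "?L \<le> k \<longleftrightarrow> ?E k")
proof
  have "?E m" using assms by blast
  then have "?E ?L" by (rule LeastI)
  moreover assume "?L \<le> k"
  ultimately show "?E k" by (meson lessThan_subset_iff order_trans)
next
  assume "?E k" then show "?L \<le> k" by (rule Least_le)
qed

lemma injective_distinguishing:
  assumes "inj_on c (verts G)" shows "distinguishing G c"
  unfolding distinguishing_def automorphism_def
  using assms by (meson bij_betwE inj_onD)

lemma injective_proper:
  assumes "simple_graph G" "inj_on c (verts G)" shows "proper_coloring G c"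
  unfolding proper_coloring_def using assms by (metis inj_onD not_adjacent_self)

lemma injective_colouring:
  assumes "simple_graph G"
  obtains c :: "'a \<Rightarrow> nat" where "c ` verts G \<subseteq> {..<card (verts G)}" "inj_on c (verts G)"
  using ex_bij_betw_finite_nat[OF finite_verts[OF assms]]
  by (metis atLeast0LessThan bij_betw_def order_refl)

lemma chromatic_number_le_iff:
  assumes "simple_graph G"
  shows "chromatic_number G \<le> k \<longleftrightarrow> (\<exists>c. c ` verts G \<subseteq> {..<k} \<and> proper_coloring G c)"
  unfolding chromatic_number_def
  by (rule injective_colouring[OF assms])
     (rule least_colours_le_iff, assumption, rule injective_proper[OF assms])

lemma distinguishing_number_le_iff:
  assumes "simple_graph G"
  shows "distinguishing_number G \<le> k \<longleftrightarrow> (\<exists>c. c ` verts G \<subseteq> {..<k} \<and> distinguishing G c)"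
  unfolding distinguishing_number_def
  by (rule injective_colouring[OF assms])
     (rule least_colours_le_iff, assumption, rule injective_distinguishing)

lemma distinguishing_chromatic_number_le_iff:
  assumes "simple_graph G"
  shows "distinguishing_chromatic_number G \<le> k \<longleftrightarrow>
    (\<exists>c. c ` verts G \<subseteq> {..<k} \<and> proper_coloring G c \<and> distinguishing G c)"
  unfolding distinguishing_chromatic_number_def
  by (rule injective_colouring[OF assms])
     (rule least_colours_le_iff, assumption,
      simp add: injective_distinguishing injective_proper[OF assms])

lemma chromatic_number_le_card:
  assumes "simple_graph G" shows "chromatic_number G \<le> card (verts G)"
  unfolding chromatic_number_le_iff[OF assms]
  by (meson injective_colouring[OF assms] injective_proper[OF assms])

lemma clique_le_chromatic_number:
  assumes "simple_graph G" "K \<subseteq> verts G"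
    and "\<And>u v. u \<in> K \<Longrightarrow> v \<in> K \<Longrightarrow> u \<noteq> v \<Longrightarrow> adjacent G u v"
  shows "card K \<le> chromatic_number G"
proof -
  obtain c where c: "c ` verts G \<subseteq> {..<chromatic_number G}" "proper_coloring G c"
    using chromatic_number_le_iff[OF assms(1)] by blast
  have "inj_on c K" using c(2) assms(2,3) unfolding proper_coloring_def inj_on_def by blast
  moreover have "c ` K \<subseteq> {..<chromatic_number G}" using c(1) assms(2) by blast
  ultimately show ?thesis by (metis card_inj_on_le card_lessThan finite_lessThan)
qed

lemma chromatic_number_delete_stable:
  assumes "simple_graph G"
    and "\<And>u v. u \<in> S \<Longrightarrow> v \<in> S \<Longrightarrow> \<not> adjacent G u v"
  shows "chromatic_number G \<le> Suc (chromatic_number (delete_verts G S))"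
proof -
  let ?k = "chromatic_number (delete_verts G S)"
  obtain c where c: "c ` (verts G - S) \<subseteq> {..<?k}" "proper_coloring (delete_verts G S) c"
    using chromatic_number_le_iff[OF simple_induced[OF assms(1)], of "verts G - S" ?k]
    by (auto simp: Int_absorb1)
  define d where "d v = (if v \<in> S then ?k else c v)" for v
  have lt: "c v < ?k" if "v \<in> verts G" "v \<notin> S" for v using c(1) that by auto
  have "d ` verts G \<subseteq> {..<Suc ?k}" using lt by (auto simp: d_def less_SucI)
  moreover have "proper_coloring G d"
    using c(2) assms(2) lt unfolding proper_coloring_def d_def by (simp, metis less_irrefl)
  ultimately show ?thesis unfolding chromatic_number_le_iff[OF assms(1)] by blast
qed

lemma chromatic_number_delete_vertex:
  assumes "simple_graph G"
  shows "chromatic_number G \<le> Suc (chromatic_number (delete_verts G {v}))"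
  using not_adjacent_self[OF assms] by (intro chromatic_number_delete_stable[OF assms]) simp

text \<open>
  The neighbours of \<open>v\<close> do not use up the colours of an optimal colouring of the rest, so \<open>v\<close>
  can be coloured greedily.
\<close>

lemma chromatic_number_delete_low_degree:
  assumes "simple_graph G"
    and "degree G v < chromatic_number (delete_verts G {v})"
  shows "chromatic_number G \<le> chromatic_number (delete_verts G {v})"
proof -
  let ?k = "chromatic_number (delete_verts G {v})"
  obtain c where c: "c ` (verts G - {v}) \<subseteq> {..<?k}" "proper_coloring (delete_verts G {v}) c"
    using chromatic_number_le_iff[OF simple_induced[OF assms(1)], of "verts G - {v}" ?k]
    by (auto simp: Int_absorb1)
  have "card (c ` nbhd G v) < card {..<?k}"
    using card_image_le[OF finite_nbhd[OF assms(1)], of c v] assms(2) by (simp add: degree_nbhd)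
  then obtain x where x: "x < ?k" "x \<notin> c ` nbhd G v"
    by (metis card_mono finite_imageI finite_nbhd[OF assms(1)] lessThan_iff not_le subsetI)
  have "c(v := x) ` verts G \<subseteq> {..<?k}" using c(1) x(1) by auto
  moreover have "proper_coloring G (c(v := x))"
    using c(2) x(2) not_adjacent_self[OF assms(1)] adjacent_sym[of G v]
    unfolding proper_coloring_def nbhd_def by auto
  ultimately show ?thesis unfolding chromatic_number_le_iff[OF assms(1)] by blast
qed

section \<open>The structure of NG-graphs\<close>

text \<open>
  Induction on the order: adding \<open>v\<close> raises each chromatic number by at most one. If both were
  raised, then \<open>v\<close> would have at least \<open>p\<close> neighbours and at least \<open>q\<close> non-neighbours, where
  \<open>p, q\<close> are the values before adding \<open>v\<close>; so \<open>p + q \<le> n - 1\<close> for the new order \<open>n\<close>, and the bound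
  still holds.
\<close>

theorem Nordhaus_Gaddum_upper_bound:
  assumes "simple_graph G"
  shows "chromatic_number G + chromatic_number (graph_complement G) \<le> card (verts G) + 1"
  using assms
proof (induction "card (verts G)" arbitrary: G)
  case 0
  then show ?case
    using chromatic_number_le_card[of G] chromatic_number_le_card[of "graph_complement G"]
    by (simp add: simple_complement)
next
  case (Suc n)
  let ?H = "graph_complement G"
  obtain v where v: "v \<in> verts G" using Suc.hyps(2) by fastforce
  let ?p = "chromatic_number (delete_verts G {v})"
  let ?q = "chromatic_number (delete_verts ?H {v})"
  note s = Suc.prems simple_complement[OF Suc.prems]
  have IH: "?p + ?q \<le> n + 1"
    using Suc.hyps(1)[OF _ simple_induced[OF s(1)], of "verts G - {v}"]
      card_delete_vertex[OF s(1) v] Suc.hyps(2) complement_induced[OF s(1)] by simp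
  have "chromatic_number G \<le> Suc ?p" "chromatic_number ?H \<le> Suc ?q"
    by (rule chromatic_number_delete_vertex[OF s(1)], rule chromatic_number_delete_vertex[OF s(2)])
  moreover have "degree G v < ?p \<Longrightarrow> chromatic_number G \<le> ?p"
    "degree ?H v < ?q \<Longrightarrow> chromatic_number ?H \<le> ?q"
    by (rule chromatic_number_delete_low_degree[OF s(1)],
        assumption, rule chromatic_number_delete_low_degree[OF s(2)])
  ultimately show ?case
    using IH degree_complement[OF s(1) v] Suc.hyps(2) by linarith
qed

lemma NG_complement: "simple_graph G \<Longrightarrow> NG_graph (graph_complement G) \<longleftrightarrow> NG_graph G"
  by (simp add: NG_graph_def complement_complement add.commute)

text \<open>
  Every statement about \<open>B\<close> thus has a dual about \<open>C\<close>: in an NG-graph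
  \<open>deg v - (\<chi>(G) - 1)\<close> changes sign under complementation.
\<close>

lemma ABC_complement:
  assumes "simple_graph G" "NG_graph G"
  shows "A_set (graph_complement G) = A_set G"
    and "B_set (graph_complement G) = C_set G"
    and "C_set (graph_complement G) = B_set G"
  using degree_complement[OF assms(1)] assms(2)
  by (force simp: A_set_def B_set_def C_set_def NG_graph_def)+

text \<open>
  In the complement \<open>v\<close> has degree below \<open>\<chi> - 1\<close>, so its deletion cannot lower \<open>\<chi>\<close> there
  (otherwise \<open>v\<close> could be added back greedily). The upper bound for the graph without \<open>v\<close> then
  forces \<open>\<chi>(G)\<close> to drop, and equality holds throughout.
\<close>

lemma NG_delete_high_degree:
  assumes s: "simple_graph G" and NG: "NG_graph G" and v: "v \<in> B_set G"
  shows "Suc (chromatic_number (delete_verts G {v})) = chromatic_number G"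
    and "NG_graph (delete_verts G {v})"
proof -
  let ?H = "graph_complement G"
  note sH = simple_complement[OF s]
  have vG: "v \<in> verts G" using v by (simp add: B_set_def)
  have le: "chromatic_number G \<le> Suc (chromatic_number (delete_verts G {v}))"
    "chromatic_number ?H \<le> Suc (chromatic_number (delete_verts ?H {v}))"
    by (rule chromatic_number_delete_vertex[OF s], rule chromatic_number_delete_vertex[OF sH])
  have low: "degree ?H v < chromatic_number (delete_verts ?H {v}) \<Longrightarrow>
      chromatic_number ?H \<le> chromatic_number (delete_verts ?H {v})"
    by (rule chromatic_number_delete_low_degree[OF sH])
  have ub: "chromatic_number (delete_verts G {v}) + chromatic_number (delete_verts ?H {v})
      \<le> card (verts (delete_verts G {v})) + 1"
    using Nordhaus_Gaddum_upper_bound[OF simple_induced[OF s]] complement_induced[OF s] by simp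
  have NG': "chromatic_number G + chromatic_number ?H = card (verts G) + 1"
    using NG by (simp add: NG_graph_def)
  have high: "degree G v + 1 > chromatic_number G" using v by (simp add: B_set_def)
  note facts = le low ub NG' high degree_complement[OF s vG] card_delete_vertex[OF s vG]
  show *: "Suc (chromatic_number (delete_verts G {v})) = chromatic_number G"
    using facts by linarith
  have "chromatic_number (graph_complement (delete_verts G {v}))
      = chromatic_number (delete_verts ?H {v})"
    using complement_induced[OF s] by simp
  then show "NG_graph (delete_verts G {v})"
    unfolding NG_graph_def using facts * by linarith
qed

text \<open>
  Deleting \<open>v\<close> lowers \<open>\<chi>\<close>. If \<open>u\<close> were not adjacent to \<open>v\<close>, its degree would stay the same, so
  \<open>u\<close> would lie in \<open>B\<close> of the remaining NG-graph, and deleting it would lower \<open>\<chi>\<close> again. But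
  \<open>u\<close> and \<open>v\<close> can share a single additional colour.
\<close>

lemma NG_B_complete:
  assumes s: "simple_graph G" and NG: "NG_graph G"
    and v: "v \<in> B_set G" and u: "u \<in> A_set G \<union> B_set G" and "u \<noteq> v"
  shows "adjacent G u v"
proof (rule ccontr)
  assume na: "\<not> adjacent G u v"
  let ?G' = "delete_verts G {v}"
  have "nbhd ?G' u = nbhd G u"
    using na \<open>u \<noteq> v\<close> u by (auto simp: nbhd_def A_set_def B_set_def)
  then have "u \<in> B_set ?G'"
    using u \<open>u \<noteq> v\<close> NG_delete_high_degree(1)[OF s NG v]
    by (auto simp: A_set_def B_set_def degree_nbhd)
  then have *: "Suc (chromatic_number (delete_verts ?G' {u})) = chromatic_number ?G'"
    using NG_delete_high_degree(1)[OF simple_induced[OF s] NG_delete_high_degree(2)[OF s NG v]]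
    by blast
  have "delete_verts ?G' {u} = delete_verts G {u, v}"
  proof -
    have "(verts G - {v}) \<inter> (verts ?G' - {u}) = verts G - {u, v}" by auto
    then show ?thesis by (simp only: induced_induced)
  qed
  with * have "Suc (chromatic_number (delete_verts G {u, v})) = chromatic_number ?G'"
    by (simp only:)
  moreover have "chromatic_number G \<le> Suc (chromatic_number (delete_verts G {u, v}))"
    using na adjacent_sym[of G u v] not_adjacent_self[OF s]
    by (intro chromatic_number_delete_stable[OF s]) auto
  ultimately show False using NG_delete_high_degree(1)[OF s NG v] by linarith
qed

lemma NG_C_anticomplete:
  assumes s: "simple_graph G" and NG: "NG_graph G"
    and v: "v \<in> C_set G" and u: "u \<in> A_set G \<union> C_set G"
  shows "\<not> adjacent G u v"
proof (cases "u = v")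
  case True
  then show ?thesis by (simp add: not_adjacent_self[OF s])
next
  case False
  have "adjacent (graph_complement G) u v"
    using NG_B_complete[OF simple_complement[OF s]] NG u v False
    by (simp add: ABC_complement[OF s NG] NG_complement[OF s])
  then show ?thesis by (simp add: adjacent_complement)
qed

lemma ABC_partition:
  "verts G = A_set G \<union> B_set G \<union> C_set G"
  "A_set G \<inter> B_set G = {}" "A_set G \<inter> C_set G = {}" "B_set G \<inter> C_set G = {}"
  by (auto simp: A_set_def B_set_def C_set_def)

text \<open>
  If \<open>A\<close> is empty, the graph consists of \<open>B\<close> and the stable set \<open>C\<close>, so \<open>\<chi> \<le> b + 1\<close>. Hence
  vertices of \<open>C\<close> have degree less than \<open>b\<close>, and each has a non-neighbour in \<open>B\<close> whose colour it
  can reuse. Applied to the graph and to its complement, this makes the sum of the chromatic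
  numbers at most \<open>n\<close>, which is how \<open>NG_A_nonempty\<close> follows.
\<close>

lemma NG_chromatic_number_le_card_B:
  assumes s: "simple_graph G" and NG: "NG_graph G" and A: "A_set G = {}"
  shows "chromatic_number G \<le> card (B_set G)"
proof -
  note P = ABC_partition[of G]
  have B: "delete_verts G (C_set G) = induced_subgraph G (B_set G)" "verts G \<inter> B_set G = B_set G"
    using P A by (auto intro: arg_cong[where f = "induced_subgraph G"])
  have finB: "finite (B_set G)" using finite_verts[OF s] P(1) by simp
  have "chromatic_number G \<le> Suc (chromatic_number (delete_verts G (C_set G)))"
    using NG_C_anticomplete[OF s NG] by (intro chromatic_number_delete_stable[OF s]) auto
  also have "\<dots> \<le> Suc (card (B_set G))"
    using chromatic_number_le_card[OF simple_induced[OF s], of "B_set G"] B by simp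
  finally have le: "chromatic_number G \<le> Suc (card (B_set G))" .
  have "\<exists>w. w \<in> B_set G \<and> \<not> adjacent G v w" if v: "v \<in> C_set G" for v
  proof (rule ccontr)
    assume "\<nexists>w. w \<in> B_set G \<and> \<not> adjacent G v w"
    then have "B_set G \<subseteq> nbhd G v" using P(1) by (auto simp: nbhd_def)
    then have "card (B_set G) \<le> degree G v"
      using card_mono[OF finite_nbhd[OF s]] by (simp add: degree_nbhd)
    then show False using v le by (simp add: C_set_def)
  qed
  then obtain w where w: "\<And>v. v \<in> C_set G \<Longrightarrow> w v \<in> B_set G \<and> \<not> adjacent G v (w v)" by metis
  obtain c :: "'a \<Rightarrow> nat" where c: "c ` B_set G \<subseteq> {..<card (B_set G)}" "inj_on c (B_set G)"
    using ex_bij_betw_finite_nat[OF finB] by (metis atLeast0LessThan bij_betw_def order_refl)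
  define d where "d v = (if v \<in> C_set G then c (w v) else c v)" for v
  have "d ` verts G \<subseteq> {..<card (B_set G)}"
    using c(1) w P A by (auto simp: d_def)
  moreover have "proper_coloring G d"
    unfolding proper_coloring_def
  proof (intro ballI impI notI)
    fix x y assume xy: "x \<in> verts G" "y \<in> verts G" "adjacent G x y" "d x = d y"
    have "x \<noteq> y" using xy not_adjacent_self[OF s] by auto
    show False
    proof (cases "x \<in> C_set G"; cases "y \<in> C_set G")
      assume "x \<in> C_set G" "y \<in> C_set G"
      then show False using NG_C_anticomplete[OF s NG] xy by blast
    next
      assume "x \<in> C_set G" "y \<notin> C_set G"
      then have "w x = y" using xy P(1) A w inj_onD[OF c(2)] by (auto simp: d_def)
      then show False using w \<open>x \<in> C_set G\<close> xy by blast
    next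
      assume "x \<notin> C_set G" "y \<in> C_set G"
      then have "w y = x" using xy P(1) A w inj_onD[OF c(2)] by (auto simp: d_def)
      then show False using w \<open>y \<in> C_set G\<close> xy adjacent_sym by metis
    next
      assume "x \<notin> C_set G" "y \<notin> C_set G"
      then show False using xy P(1) A \<open>x \<noteq> y\<close> inj_onD[OF c(2)] by (auto simp: d_def)
    qed
  qed
  ultimately show ?thesis unfolding chromatic_number_le_iff[OF s] by blast
qed

lemma NG_A_nonempty:
  assumes s: "simple_graph G" and NG: "NG_graph G"
  shows "A_set G \<noteq> {}"
proof
  assume A: "A_set G = {}"
  have "chromatic_number (graph_complement G) \<le> card (C_set G)"
    using NG_chromatic_number_le_card_B[OF simple_complement[OF s]] NG A
    by (simp add: ABC_complement[OF s NG] NG_complement[OF s])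
  moreover have "card (verts G) = card (B_set G) + card (C_set G)"
    using ABC_partition[of G] A finite_verts[OF s] by (metis card_Un_disjoint finite_Un sup_bot_left)
  ultimately show False
    using NG_chromatic_number_le_card_B[OF s NG A] NG by (simp add: NG_graph_def)
qed

section \<open>Twins and automorphisms\<close>

text \<open>Leaving out \<open>x\<close> and \<open>y\<close> themselves admits adjacent as well as nonadjacent twins.\<close>

definition twins :: "'a ugraph \<Rightarrow> 'a \<Rightarrow> 'a \<Rightarrow> bool" where
  "twins G x y \<longleftrightarrow> x \<in> verts G \<and> y \<in> verts G \<and>
     (\<forall>z \<in> verts G - {x, y}. adjacent G x z \<longleftrightarrow> adjacent G y z)"

lemma twins_complement: "twins (graph_complement G) x y \<longleftrightarrow> twins G x y"
  by (auto simp: twins_def adjacent_complement)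

lemma twins_automorphism:
  assumes s: "simple_graph G" and t: "twins G x y"
  shows "automorphism G (\<lambda>z. if z = x then y else if z = y then x else z)" (is "automorphism G ?f")
proof -
  have xy: "x \<in> verts G" "y \<in> verts G"
    and tw: "\<And>z. z \<in> verts G \<Longrightarrow> z \<noteq> x \<Longrightarrow> z \<noteq> y \<Longrightarrow> adjacent G x z \<longleftrightarrow> adjacent G y z"
    using t by (auto simp: twins_def)
  have tw': "adjacent G z x \<longleftrightarrow> adjacent G z y" if "z \<in> verts G" "z \<noteq> x" "z \<noteq> y" for z
    using tw[OF that] adjacent_sym[of G x z] adjacent_sym[of G y z] by (simp only:)
  have "bij_betw ?f (verts G) (verts G)"
    by (rule bij_betw_byWitness[where f' = ?f]) (use xy in auto)
  moreover have "adjacent G (?f u) (?f v) \<longleftrightarrow> adjacent G u v"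
    if "u \<in> verts G" "v \<in> verts G" for u v
    using that tw[of u] tw[of v] tw'[of u] tw'[of v] adjacent_sym[of G x y]
      not_adjacent_self[OF s, of x] not_adjacent_self[OF s, of y]
    by (smt (verit))
  ultimately show ?thesis by (simp add: automorphism_def)
qed

lemma distinguishing_twins:
  assumes s: "simple_graph G" and d: "distinguishing G c" and t: "twins G x y" and "x \<noteq> y"
  shows "c x \<noteq> c y"
proof
  assume "c x = c y"
  then have "\<forall>v \<in> verts G. (if v = x then y else if v = y then x else v) = v"
    using d twins_automorphism[OF s t] unfolding distinguishing_def by fastforce
  then show False using t \<open>x \<noteq> y\<close> by (auto simp: twins_def)
qed

lemma distinguishing_inj_on_twins:
  assumes "simple_graph G" "distinguishing G c"
    and "\<And>x y. x \<in> T \<Longrightarrow> y \<in> T \<Longrightarrow> twins G x y"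
  shows "inj_on c T"
  using distinguishing_twins[OF assms(1,2)] assms(3) unfolding inj_on_def by blast

text \<open>
  Exchanging two twins is an automorphism, so a distinguishing colouring separates them.
\<close>

lemma card_twins_le_distinguishing_number:
  assumes s: "simple_graph G"
    and t: "\<And>x y. x \<in> T \<Longrightarrow> y \<in> T \<Longrightarrow> twins G x y"
  shows "card T \<le> distinguishing_number G"
proof -
  obtain c where c: "c ` verts G \<subseteq> {..<distinguishing_number G}" "distinguishing G c"
    using distinguishing_number_le_iff[OF s] by blast
  have "c ` T \<subseteq> {..<distinguishing_number G}" using c(1) t by (force simp: twins_def)
  then show ?thesis
    using distinguishing_inj_on_twins[OF s c(2)] t
    by (metis card_inj_on_le card_lessThan finite_lessThan)
qed

lemma automorphism_nbhd:
  assumes "automorphism G f" "v \<in> verts G"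
  shows "nbhd G (f v) = f ` nbhd G v"
proof -
  have im: "f ` verts G = verts G" using assms(1) by (simp add: automorphism_def bij_betw_def)
  show ?thesis
    using assms im unfolding automorphism_def nbhd_def by (auto simp: image_iff) (metis imageE)
qed

lemma automorphism_degree:
  assumes "automorphism G f" "v \<in> verts G"
  shows "degree G (f v) = degree G v"
proof -
  have "inj_on f (nbhd G v)"
    using assms(1) by (auto simp: automorphism_def bij_betw_def nbhd_def intro: inj_on_subset)
  then show ?thesis using automorphism_nbhd[OF assms] by (simp add: degree_nbhd card_image)
qed

section \<open>The distinguishing chromatic number of a split-like graph\<close>

text \<open>
  The common shape of a Type 1 NG-graph, with \<open>(P, Q) = (B, C)\<close>, and of its complement, with
  \<open>(P, Q) = (C, B)\<close>. The set \<open>A\<close> is a clique in the first and stable in the second, and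
  \<open>A_twins\<close> covers both. The degree condition makes every automorphism preserve \<open>Q\<close>.
\<close>

locale split_like_graph =
  fixes H :: "'a ugraph" and A P Q :: "'a set"
  assumes simple: "simple_graph H"
    and verts_eq: "verts H = A \<union> P \<union> Q"
    and disjoint: "A \<inter> P = {}" "A \<inter> Q = {}" "P \<inter> Q = {}"
    and A_twins: "x \<in> A \<Longrightarrow> y \<in> A \<Longrightarrow> twins H x y"
    and AP_complete: "x \<in> A \<Longrightarrow> p \<in> P \<Longrightarrow> adjacent H x p"
    and P_clique: "p \<in> P \<Longrightarrow> p' \<in> P \<Longrightarrow> p \<noteq> p' \<Longrightarrow> adjacent H p p'"
    and Q_anticomplete: "q \<in> Q \<Longrightarrow> r \<in> A \<union> Q \<Longrightarrow> \<not> adjacent H q r"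
    and Q_degree: "q \<in> Q \<Longrightarrow> r \<in> A \<union> P \<Longrightarrow> degree H q \<noteq> degree H r"
begin

definition twin_class :: "'a \<Rightarrow> 'a set" where
  "twin_class q = {r \<in> Q. nbhd H r = nbhd H q}"

lemma finite_parts: "finite A" "finite P" "finite Q"
  using finite_verts[OF simple] verts_eq by auto

lemma nbhd_Q: "q \<in> Q \<Longrightarrow> nbhd H q \<subseteq> P"
  using Q_anticomplete verts_eq by (auto simp: nbhd_def)

lemma twin_class_twins: "x \<in> twin_class q \<Longrightarrow> y \<in> twin_class q \<Longrightarrow> twins H x y"
  using verts_eq unfolding twin_class_def twins_def nbhd_def by blast

text \<open>
  The sets \<open>A \<union> P\<close> and \<open>twin_class q \<union> nbhd H q\<close> receive pairwise different colours: two of their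
  vertices are adjacent or twins.
\<close>

lemma colour_bounds:
  assumes c: "c ` verts H \<subseteq> {..<k}" "proper_coloring H c" "distinguishing H c"
  shows "card A + card P \<le> k"
    and "q \<in> Q \<Longrightarrow> card (twin_class q) + card (nbhd H q) \<le> k"
proof -
  have ne: "c x \<noteq> c y" if "adjacent H x y" for x y
    using c(2) that adjacent_in_verts[OF simple] unfolding proper_coloring_def by blast
  have injP: "inj_on c P" using P_clique ne unfolding inj_on_def by blast
  have sub: "card (c ` S) \<le> k" if "S \<subseteq> verts H" for S
    using c(1) that by (metis card_lessThan card_mono finite_lessThan image_mono order_trans)
  have "inj_on c A" using distinguishing_inj_on_twins[OF simple c(3)] A_twins by blast
  then have "inj_on c (A \<union> P)"
    using injP AP_complete ne unfolding inj_on_def by (metis Un_iff)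
  then show "card A + card P \<le> k"
    using sub[of "A \<union> P"] verts_eq disjoint(1) finite_parts
    by (simp add: card_image card_Un_disjoint)
  assume q: "q \<in> Q"
  have injT: "inj_on c (twin_class q)"
    using distinguishing_inj_on_twins[OF simple c(3)] twin_class_twins by blast
  have "inj_on c (nbhd H q)" using injP nbhd_Q[OF q] by (rule inj_on_subset)
  moreover have "c x \<noteq> c y" if "x \<in> twin_class q" "y \<in> nbhd H q" for x y
    using that ne by (auto simp: twin_class_def nbhd_def)
  ultimately have "inj_on c (twin_class q \<union> nbhd H q)"
    using injT unfolding inj_on_def by (metis Un_iff)
  moreover have "twin_class q \<inter> nbhd H q = {}"
    using nbhd_Q[OF q] disjoint(3) by (auto simp: twin_class_def)
  moreover have "twin_class q \<union> nbhd H q \<subseteq> verts H" "finite (twin_class q)"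
    using finite_parts verts_eq by (auto simp: twin_class_def nbhd_def)
  ultimately show "card (twin_class q) + card (nbhd H q) \<le> k"
    using sub[of "twin_class q \<union> nbhd H q"] finite_nbhd[OF simple]
    by (simp add: card_image card_Un_disjoint)
qed

text \<open>
  A colour-preserving automorphism maps \<open>A \<union> P\<close> to itself, so it fixes this set pointwise. It
  therefore keeps the neighbourhood of every vertex of \<open>Q\<close>, so it moves vertices only within
  twin classes, where colours differ.
\<close>

lemma distinguishingI:
  assumes AP: "inj_on c (A \<union> P)" and Q: "\<And>q. q \<in> Q \<Longrightarrow> inj_on c (twin_class q)"
  shows "distinguishing H c"
  unfolding distinguishing_def
proof (intro allI impI ballI)
  fix f v
  assume f: "automorphism H f \<and> (\<forall>v \<in> verts H. c (f v) = c v)" and v: "v \<in> verts H"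
  have f_verts: "f u \<in> verts H" if "u \<in> verts H" for u
    using f that by (auto simp: automorphism_def bij_betw_def)
  have deg: "degree H (f u) = degree H u" if "u \<in> verts H" for u
    using automorphism_degree[OF conjunct1[OF f] that] .
  have fixed: "f u = u" if u: "u \<in> A \<union> P" for u
  proof -
    have "f u \<notin> Q" using Q_degree[of "f u" u] deg[of u] u verts_eq by auto
    then have "f u \<in> A \<union> P" using f_verts[of u] u verts_eq by auto
    then show ?thesis using f u verts_eq inj_onD[OF AP] by auto
  qed
  show "f v = v"
  proof (cases "v \<in> Q")
    case True
    have "f v \<in> Q" using Q_degree[of v "f v"] deg[OF v] True f_verts[OF v] verts_eq by auto
    moreover have "nbhd H (f v) = nbhd H v"
      using f v fixed nbhd_Q[OF True] by (simp add: automorphism_nbhd subset_iff)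
    ultimately show ?thesis
      using True f v inj_onD[OF Q[OF True]] by (simp add: twin_class_def)
  next
    case False
    then show ?thesis using fixed v verts_eq by auto
  qed
qed

text \<open>
  First colour \<open>A \<union> P\<close> injectively by \<open>h\<close>; then each twin class gets distinct colours not
  occurring on its neighbourhood. Different classes do not interact, since \<open>Q\<close> is stable.
\<close>

lemma exists_colouring:
  assumes AP: "card A + card P \<le> k"
    and Q: "\<And>q. q \<in> Q \<Longrightarrow> card (twin_class q) + card (nbhd H q) \<le> k"
  shows "\<exists>c. c ` verts H \<subseteq> {..<k} \<and> proper_coloring H c \<and> distinguishing H c"
proof -
  have "card (A \<union> P) \<le> card {..<k}"
    using AP disjoint(1) finite_parts by (simp add: card_Un_disjoint)
  then obtain h where h: "h ` (A \<union> P) \<subseteq> {..<k}" "inj_on h (A \<union> P)"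
    using card_le_inj[of "A \<union> P" "{..<k}"] finite_parts by auto
  have "\<exists>g. g ` twin_class q \<subseteq> {..<k} - h ` nbhd H q \<and> inj_on g (twin_class q)"
    if q: "q \<in> Q" for q
  proof -
    have "h ` nbhd H q \<subseteq> {..<k}" using h(1) nbhd_Q[OF q] by blast
    then have "card ({..<k} - h ` nbhd H q) = k - card (h ` nbhd H q)"
      by (simp add: card_Diff_subset finite_nbhd[OF simple])
    moreover have "card (h ` nbhd H q) \<le> card (nbhd H q)"
      by (simp add: card_image_le finite_nbhd[OF simple])
    ultimately have "card (twin_class q) \<le> card ({..<k} - h ` nbhd H q)"
      using Q[OF q] by linarith
    then show ?thesis
      using card_le_inj[of "twin_class q" "{..<k} - h ` nbhd H q"] finite_parts(3)
      by (auto simp: twin_class_def)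
  qed
  (* The injection is chosen per neighbourhood, so that twins use the same one. *)
  then have "\<forall>N. \<exists>g. \<forall>q \<in> Q. nbhd H q = N \<longrightarrow>
      g ` twin_class q \<subseteq> {..<k} - h ` N \<and> inj_on g (twin_class q)"
    by (metis twin_class_def)
  then obtain g where g: "\<And>q. q \<in> Q \<Longrightarrow>
      g (nbhd H q) ` twin_class q \<subseteq> {..<k} - h ` nbhd H q \<and> inj_on (g (nbhd H q)) (twin_class q)"
    by metis
  define c where "c v = (if v \<in> Q then g (nbhd H v) v else h v)" for v
  have c_AP: "c v = h v" if "v \<in> A \<union> P" for v using that disjoint by (auto simp: c_def)
  have c_Q: "c q < k" "c q \<notin> h ` nbhd H q" if "q \<in> Q" for q
    using g[OF that] that by (auto simp: c_def twin_class_def)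
  have inj: "inj_on c (A \<union> P)" using h(2) c_AP by (metis inj_on_cong)
  have "inj_on c (twin_class q)" if "q \<in> Q" for q
    using g[OF that] unfolding inj_on_def by (auto simp: c_def twin_class_def)
  then have "distinguishing H c" using distinguishingI[OF inj] by blast
  moreover have "c ` verts H \<subseteq> {..<k}" using c_Q(1) h(1) c_AP verts_eq by auto
  moreover have "proper_coloring H c"
  proof -
    have PQ: "c q \<noteq> c p" if "q \<in> Q" "adjacent H q p" for q p
    proof -
      have "p \<in> nbhd H q" using that adjacent_in_verts[OF simple] by (auto simp: nbhd_def)
      then show ?thesis using c_Q(2)[OF that(1)] nbhd_Q[OF that(1)] c_AP by auto
    qed
    show ?thesis
      unfolding proper_coloring_def
      using PQ inj verts_eq adjacent_sym[of H] not_adjacent_self[OF simple]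
      by (metis Un_iff inj_onD)
  qed
  ultimately show ?thesis by blast
qed

theorem distinguishing_chromatic_number_le:
  "distinguishing_chromatic_number H \<le> k \<longleftrightarrow>
     card A + card P \<le> k \<and> (\<forall>q \<in> Q. card (twin_class q) + card (nbhd H q) \<le> k)"
  unfolding distinguishing_chromatic_number_le_iff[OF simple]
  using colour_bounds exists_colouring by blast

text \<open>
  The least \<open>k\<close> satisfying the lower bounds attains one of them. Nonemptiness of \<open>A\<close> makes it
  positive, so that \<open>k - 1\<close> is a proper decrease.
\<close>

lemma distinguishing_chromatic_number_cases:
  assumes "A \<noteq> {}"
  obtains "distinguishing_chromatic_number H = card A + card P"
  | q where "q \<in> Q"
      "distinguishing_chromatic_number H = card (twin_class q) + card (nbhd H q)"
proof -
  let ?d = "distinguishing_chromatic_number H"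
  have le: "card A + card P \<le> ?d" "\<And>q. q \<in> Q \<Longrightarrow> card (twin_class q) + card (nbhd H q) \<le> ?d"
    using distinguishing_chromatic_number_le[of ?d] by auto
  have "0 < card A" using assms finite_parts by (simp add: card_gt_0_iff)
  then have "\<not> ?d \<le> ?d - 1" using le(1) by linarith
  then have "\<not> card A + card P \<le> ?d - 1 \<or>
      (\<exists>q \<in> Q. \<not> card (twin_class q) + card (nbhd H q) \<le> ?d - 1)"
    using distinguishing_chromatic_number_le[of "?d - 1"] by blast
  then show ?thesis
  proof (elim disjE bexE)
    assume "\<not> card A + card P \<le> ?d - 1"
    then show ?thesis using le(1) that(1) by linarith
  next
    fix q assume "q \<in> Q" "\<not> card (twin_class q) + card (nbhd H q) \<le> ?d - 1"
    then show ?thesis using le(2)[of q] that(2)[of q] by linarith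
  qed
qed

end

section \<open>Type 1 NG-graphs\<close>

lemma type1_A_clique:
  assumes "type1 G" "x \<in> A_set G" "y \<in> A_set G" "x \<noteq> y"
  shows "adjacent G x y"
  using assms ABC_partition(1)[of G] by (simp add: type1_def is_clique_def)

text \<open>
  \<open>A \<union> B\<close> is a clique, so \<open>\<chi>(G) \<ge> a + b\<close>, and the degree of a vertex of \<open>B\<close> exceeds the number
  \<open>a + b - 1\<close> of its neighbours inside the clique.
\<close>

lemma type1_B_has_C_neighbour:
  assumes s: "simple_graph G" and NG: "NG_graph G" and t1: "type1 G" and r: "r \<in> B_set G"
  shows "\<exists>q \<in> C_set G. adjacent G r q"
proof (rule ccontr)
  assume none: "\<not> (\<exists>q \<in> C_set G. adjacent G r q)"
  let ?K = "A_set G \<union> B_set G"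
  have K: "?K \<subseteq> verts G" using ABC_partition(1)[of G] by auto
  have "adjacent G x y" if "x \<in> ?K" "y \<in> ?K" "x \<noteq> y" for x y
    using that type1_A_clique[OF t1] NG_B_complete[OF s NG] adjacent_sym[of G] by blast
  then have clique: "card ?K \<le> chromatic_number G"
    using K by (intro clique_le_chromatic_number[OF s])
  have "nbhd G r \<subseteq> ?K - {r}"
    using none not_adjacent_self[OF s] ABC_partition(1)[of G] by (auto simp: nbhd_def)
  then have "degree G r \<le> card (?K - {r})"
    unfolding degree_nbhd using K finite_verts[OF s] by (meson card_mono finite_Diff finite_subset)
  also have "card (?K - {r}) < card ?K"
    using r K finite_verts[OF s] by (intro card_Diff1_less) (auto intro: finite_subset)
  finally show False using clique r by (simp add: B_set_def)
qed

theorem type1_NG_split: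
  assumes s: "simple_graph G" and NG: "NG_graph G" and t1: "type1 G"
  shows "split_like_graph G (A_set G) (B_set G) (C_set G)"
    and "split_like_graph (graph_complement G) (A_set G) (C_set G) (B_set G)"
proof -
  note P = ABC_partition[of G]
  have inA: "adjacent G u v" "adjacent G v u" if "v \<in> B_set G" "u \<in> A_set G \<union> B_set G" "u \<noteq> v" for u v
    using NG_B_complete[OF s NG that] by (simp_all add: adjacent_sym)
  have inC: "\<not> adjacent G u v" "\<not> adjacent G v u" if "v \<in> C_set G" "u \<in> A_set G \<union> C_set G" for u v
    using NG_C_anticomplete[OF s NG that] by (simp_all add: adjacent_sym)
  note clA = type1_A_clique[OF t1]
  have tw: "twins G x y" if "x \<in> A_set G" "y \<in> A_set G" for x y
    using that P(1) clA inA inC unfolding twins_def by (metis DiffE Un_iff insert_iff adjacent_sym)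
  have deg: "degree G q \<noteq> degree G r"
    if "q \<in> C_set G \<and> r \<in> A_set G \<union> B_set G \<or> q \<in> B_set G \<and> r \<in> A_set G \<union> C_set G" for q r
    using that by (auto simp: A_set_def B_set_def C_set_def)
  show "split_like_graph G (A_set G) (B_set G) (C_set G)"
  proof
    show "adjacent G x p" if "x \<in> A_set G" "p \<in> B_set G" for x p
      using that P(2) by (intro inA) auto
    show "adjacent G p p'" if "p \<in> B_set G" "p' \<in> B_set G" "p \<noteq> p'" for p p'
      using that by (intro inA) auto
    show "\<not> adjacent G q r" if "q \<in> C_set G" "r \<in> A_set G \<union> C_set G" for q r
      using inC(2) that .
    show "degree G q \<noteq> degree G r" if "q \<in> C_set G" "r \<in> A_set G \<union> B_set G" for q r
      using deg that by blast
  qed (fact s P tw)+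
  have degc: "degree (graph_complement G) q \<noteq> degree (graph_complement G) r"
    if "q \<in> B_set G" "r \<in> A_set G \<union> C_set G" for q r
    using degree_complement[OF s, of q] degree_complement[OF s, of r] deg[of q r] that P(1) by auto
  show "split_like_graph (graph_complement G) (A_set G) (C_set G) (B_set G)"
  proof
    show "simple_graph (graph_complement G)" by (rule simple_complement[OF s])
    show "verts (graph_complement G) = A_set G \<union> C_set G \<union> B_set G"
      "A_set G \<inter> C_set G = {}" "A_set G \<inter> B_set G = {}" "C_set G \<inter> B_set G = {}"
      using P by auto
    show "twins (graph_complement G) x y" if "x \<in> A_set G" "y \<in> A_set G" for x y
      using tw[OF that] by (simp add: twins_complement)
    show "adjacent (graph_complement G) x p" if "x \<in> A_set G" "p \<in> C_set G" for x p
      using inC(1)[of p x] that P by (auto simp: adjacent_complement)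
    show "adjacent (graph_complement G) p p'" if "p \<in> C_set G" "p' \<in> C_set G" "p \<noteq> p'" for p p'
      using inC(1)[of p' p] that P(1) by (auto simp: adjacent_complement)
    show "\<not> adjacent (graph_complement G) q r" if "q \<in> B_set G" "r \<in> A_set G \<union> B_set G" for q r
      using inA(2)[of q r] that by (auto simp: adjacent_complement)
  qed (rule degc)
qed

theorem theorem4p12:
  fixes G :: "'a ugraph" and a l :: nat
  assumes "simple_graph G"
    and "NG_graph G"
    and "type1 G"
    and "a = card (A_set G)"
    and "l = card {v \<in> C_set G. \<forall>u \<in> B_set G. adjacent G v u}"
  shows "NGD_graph G \<longleftrightarrow> distinguishing_number G = max a l"
proof -
  note s = assms(1) and P = ABC_partition[of G]
  interpret G: split_like_graph G "A_set G" "B_set G" "C_set G"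
    using type1_NG_split assms by blast
  interpret H: split_like_graph "graph_complement G" "A_set G" "C_set G" "B_set G"
    using type1_NG_split assms by blast
  let ?D = "distinguishing_number G"
  let ?H = "graph_complement G"
  let ?x = "distinguishing_chromatic_number G" and ?y = "distinguishing_chromatic_number ?H"
  let ?t = "\<lambda>q. card (G.twin_class q)" and ?n = "\<lambda>q. card (nbhd G q)"
  let ?t' = "\<lambda>r. card (H.twin_class r)" and ?n' = "\<lambda>r. card (nbhd ?H r)"
  define b where "b = card (B_set G)"
  define c where "c = card (C_set G)"
  define L where "L = {v \<in> C_set G. \<forall>u \<in> B_set G. adjacent G v u}"
  have ne: "A_set G \<noteq> {}" by (rule NG_A_nonempty[OF assms(1,2)])
  have a: "1 \<le> a" using ne G.finite_parts(1) by (simp add: assms(4) Suc_le_eq card_gt_0_iff)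
  have l: "l = card L" by (simp add: assms(5) L_def)
  have n: "card (verts G) = a + b + c"
    using P G.finite_parts by (simp add: assms(4) b_def c_def card_Un_disjoint Int_Un_distrib2)
  have NGD: "NGD_graph G \<longleftrightarrow> ?x + ?y = a + b + c + ?D" by (simp add: NGD_graph_def n)
  have Da: "a \<le> ?D"
    unfolding assms(4) using G.A_twins by (rule card_twins_le_distinguishing_number[OF s])
  have Dt: "?t q \<le> ?D" for q
    using G.twin_class_twins by (rule card_twins_le_distinguishing_number[OF s])
  have Dt': "?t' r \<le> ?D" for r
    using H.twin_class_twins unfolding twins_complement
    by (rule card_twins_le_distinguishing_number[OF s])
  have nb: "?n q \<le> b" if "q \<in> C_set G" for q
    unfolding b_def by (rule card_mono[OF G.finite_parts(2) G.nbhd_Q[OF that]])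
  have L_iff: "q \<in> L \<longleftrightarrow> nbhd G q = B_set G" if "q \<in> C_set G" for q
    using G.nbhd_Q[OF that] that P(1) by (auto simp: L_def nbhd_def)
  have L_class: "G.twin_class q = L" if "q \<in> L" for q
    using that L_iff by (auto simp: G.twin_class_def) (auto simp: L_def)
  have Dl: "l \<le> ?D"
  proof (cases "L = {}")
    case False
    then show ?thesis using L_class Dt l by (metis ex_in_conv)
  qed (simp add: l)
  (* A vertex of L has no non-neighbour in B, so N'(r) avoids L. *)
  have n'c: "?n' r + l \<le> c" if "r \<in> B_set G" for r
  proof -
    have "nbhd ?H r \<union> L \<subseteq> C_set G" "nbhd ?H r \<inter> L = {}"
      using H.nbhd_Q[OF that] that by (auto simp: L_def nbhd_def adjacent_complement adjacent_sym)
    moreover have "finite L" using G.finite_parts by (simp add: L_def)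
    ultimately show ?thesis
      unfolding l c_def using card_mono[OF G.finite_parts(3), of "nbhd ?H r \<union> L"]
      by (simp add: card_Un_disjoint finite_nbhd[OF simple_complement[OF s]])
  qed
  have n'_less: "?n' r < c" if r: "r \<in> B_set G" for r
  proof -
    obtain q where "q \<in> C_set G" "adjacent G r q"
      using type1_B_has_C_neighbour[OF assms(1-3) r] by blast
    then have "nbhd ?H r \<subset> C_set G"
      using H.nbhd_Q[OF r] by (auto simp: nbhd_def adjacent_complement)
    then show ?thesis unfolding c_def by (rule psubset_card_mono[OF G.finite_parts(3)])
  qed
  (* Adjacency of q and r depends only on their twin classes. If they are adjacent, the class of q
     avoids the non-neighbours of r; otherwise the class of r avoids the neighbours of q. *)
  have classes: "?n q + ?t' r \<le> b \<or> ?t q + ?n' r \<le> c"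
    if q: "q \<in> C_set G" and r: "r \<in> B_set G" for q r
  proof (cases "adjacent G q r")
    case True
    have "G.twin_class q \<inter> nbhd ?H r = {}"
      using True q r P(1) adjacent_sym[of G] by (auto simp: G.twin_class_def nbhd_def adjacent_complement)
    moreover have "G.twin_class q \<union> nbhd ?H r \<subseteq> C_set G"
      using H.nbhd_Q[OF r] by (auto simp: G.twin_class_def)
    ultimately have "?t q + ?n' r \<le> c"
      unfolding c_def using card_mono[OF G.finite_parts(3)] G.finite_parts(3)
      by (metis (no_types, lifting) card_Un_disjoint finite_subset le_sup_iff)
    then show ?thesis ..
  next
    case False
    have "H.twin_class r \<inter> nbhd G q = {}"
    proof -
      have "q \<in> nbhd ?H r" using False q r P adjacent_sym[of G] by (auto simp: nbhd_def adjacent_complement)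
      then have "q \<in> nbhd ?H r'" if "r' \<in> H.twin_class r" for r'
        using that by (simp add: H.twin_class_def)
      then show ?thesis using adjacent_sym[of G] by (auto simp: nbhd_def adjacent_complement)
    qed
    moreover have "nbhd G q \<union> H.twin_class r \<subseteq> B_set G"
      using G.nbhd_Q[OF q] by (auto simp: H.twin_class_def)
    ultimately have "?n q + ?t' r \<le> b"
      unfolding b_def using card_mono[OF G.finite_parts(2)] G.finite_parts(2)
      by (metis (no_types, lifting) card_Un_disjoint finite_subset inf_commute le_sup_iff)
    then show ?thesis ..
  qed
  show ?thesis
  proof
    assume "NGD_graph G"
    then have sum: "?x + ?y = a + b + c + ?D" by (simp add: NGD)
    show "?D = max a l"
    proof (cases rule: G.distinguishing_chromatic_number_cases[OF ne])
      case 1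
      show ?thesis
      proof (cases rule: H.distinguishing_chromatic_number_cases[OF ne])
        case 1
        then show ?thesis using \<open>?x = _\<close> sum Da Dl by (simp add: assms(4) b_def c_def)
      next
        case (2 r)
        (* Impossible: this would give D + c = |S| + |N'(S)|, but |S| <= D and |N'(S)| < c. *)
        then show ?thesis using \<open>?x = _\<close> sum Dt'[of r] n'_less[of r] by (simp add: assms(4) b_def)
      qed
    next
      case (2 q)
      note q = 2
      show ?thesis
      proof (cases rule: H.distinguishing_chromatic_number_cases[OF ne])
        case 1
        (* Both bounds |T| <= D and |N(T)| <= b are tight, so T is the class of size l. *)
        then have "?D + b = ?t q + ?n q" using sum q by (simp add: assms(4) c_def)
        then have eq: "?n q = b" "?t q = ?D" using Dt[of q] nb[OF q(1)] by linarith+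
        then have "nbhd G q = B_set G"
          using G.nbhd_Q[OF q(1)] G.finite_parts by (simp add: b_def card_subset_eq)
        then have "?D = l" using L_class[of q] L_iff[OF q(1)] eq l by simp
        then show ?thesis using Da by simp
      next
        case (2 r)
        (* Impossible: by the dichotomy above, |T| + |N(T)| + |S| + |N'(S)| is at most
           b + c + D, less than the required sum because a is positive. *)
        then show ?thesis
          using sum q classes[of q r] Dt[of q] Dt'[of r] nb[of q] n'_less[of r] a by linarith
      qed
    qed
  next
    assume D: "?D = max a l"
    have "?x = b + max a l"
    proof (rule antisym)
      have "?t q + ?n q \<le> b + max a l" if "q \<in> C_set G" for q
        using Dt[of q] nb[OF that] D by linarith
      then show "?x \<le> b + max a l"
        by (simp add: G.distinguishing_chromatic_number_le assms(4) b_def)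
      have "a + b \<le> ?x" and *: "\<And>q. q \<in> C_set G \<Longrightarrow> ?t q + ?n q \<le> ?x"
        using G.distinguishing_chromatic_number_le[of ?x] by (auto simp: assms(4) b_def)
      moreover have "l + b \<le> ?x" if "l \<noteq> 0"
      proof -
        obtain q where q: "q \<in> L" using \<open>l \<noteq> 0\<close> l by fastforce
        then have "q \<in> C_set G" by (simp add: L_def)
        then show ?thesis using *[of q] L_class[OF q] L_iff q by (simp add: l b_def)
      qed
      ultimately show "b + max a l \<le> ?x" by (cases "l = 0") auto
    qed
    moreover have "?y = a + c"
    proof (rule antisym)
      (* Either |S| <= a and |N'(S)| <= c, or |S| <= l and N'(S) avoids the l vertices of L. *)
      have "?t' r + ?n' r \<le> a + c" if "r \<in> B_set G" for r
        using Dt'[of r] n'c[OF that] D by linarith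
      then show "?y \<le> a + c"
        by (simp add: H.distinguishing_chromatic_number_le assms(4) c_def)
      show "a + c \<le> ?y"
        using H.distinguishing_chromatic_number_le[of ?y] by (auto simp: assms(4) c_def)
    qed
    ultimately show "NGD_graph G" using D by (simp add: NGD)
  qed
qed

end
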